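(* Let $(X,\mathcal{S}(X),\mu)$ be a standard probability space equipped with a measurable metric $d$, and suppose that $d$ is $\mu$-regular. Let $T$ be a measurable nonsingular transformation on $X$. If $T$ is restricted pairwise sensitive, then $T$ is restricted sensitive.
   Context: The metric $d$ on $X$ is assumed measurable, so that $d$-balls are measurable. $B_r(x)=\{y: d(x,y)<r\}$ is the open ball and $\overline{B_r}(x)=\{y:d(x,y)\le r\}$ the closed ball. $\log$ is the natural logarithm, with $-\log 0=+\infty$, and $\mathbb{N}_0=\{0,1,2,\ldots\}$. $d$ is $\mu$-regular if for every $x\in X$ there exists $c>0$ such that $c\,\mu(\overline{B_r}(x))\le \mu(B_r(x))$ for all $r>0$. $T$ is restricted sensitive if for $\mu$-a.e. $x\in X$ there exist $\delta>0$ and $a>0$ such that for every $\varepsilon>0$ there exists $n\in\mathbb{N}_0$ with $n\le -a\log\mu(B_\varepsilon(x))$ and $\mu\{y\in B_\varepsilon(x): d(T^nx,T^ny)>\delta\}>0$. (Here $\delta$ and $a$ may depend on $x$.) $T$ is restricted pairwise sensitive if there exist $\delta>0$ and $a>0$ such that for $\mu\otimes\mu$-a.e. $(x,y)\in X\times X$ there exists $n\in\mathbb{N}_0$ with $n\le -a\log\mu(B_{d(x,y)}(x))$ and $d(T^nx,T^ny)>\delta$.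
   Formalization: "Measurable metric" is taken to mean that d is jointly measurable and all d-open sets are measurable; with measurability of d alone the claim fails, e.g. for d(x,y)=1+|x-y| (x≠y) on [0,1] with Lebesgue measure and T the identity. *)

theory Defs
  imports "HOL-Probability.Probability"
begin

text \<open>
  The measure space M stands for the triple of the set X, the sigma-algebra S(X) and the measure
  \<open>\<mu>\<close>, with X = \<open>space M\<close>.  The metric is a function d that need not be related to
  the topology witnessing that M is standard.
\<close>

definition standard_prob_space :: "'a measure \<Rightarrow> bool" where
  "standard_prob_space M \<longleftrightarrow> prob_space M \<and>
     (\<exists>\<tau>. completely_metrizable_space \<tau> \<and> second_countable \<tau> \<and> topspace \<tau> = space M \<and>
          sets M = sigma_sets (space M) {U. openin \<tau> U})"

text \<open>
  A metric is called measurable if it is measurable as a function of two variables and its open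
  sets belong to the sigma-algebra.  On a standard Borel space the second condition implies that
  the metric is separable, and hence implies the first; the first alone only gives measurable
  balls.  Joint measurability alone admits metrics all of whose small balls are null, such as
  \<open>d x y = 1 + \<bar>x - y\<bar>\<close> for \<open>x \<noteq> y\<close> on the unit interval with Lebesgue measure.  That metric
  is \<open>\<mu>\<close>-regular, and the identity map is restricted pairwise sensitive for it (with
  \<open>\<delta> = 1/2\<close> and \<open>n = 0\<close>) but not restricted sensitive, since balls of radius at most 1
  are singletons.
\<close>

definition measurable_metric :: "'a measure \<Rightarrow> ('a \<Rightarrow> 'a \<Rightarrow> real) \<Rightarrow> bool" where
  "measurable_metric M d \<longleftrightarrow> Metric_space (space M) d \<and>
     (\<lambda>(x, y). d x y) \<in> borel_measurable (M \<Otimes>\<^sub>M M) \<and>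
     (\<forall>U. openin (Metric_space.mtopology (space M) d) U \<longrightarrow> U \<in> sets M)"

abbreviation oball :: "'a measure \<Rightarrow> ('a \<Rightarrow> 'a \<Rightarrow> real) \<Rightarrow> 'a \<Rightarrow> real \<Rightarrow> 'a set" where
  "oball M d \<equiv> Metric_space.mball (space M) d"

abbreviation clball :: "'a measure \<Rightarrow> ('a \<Rightarrow> 'a \<Rightarrow> real) \<Rightarrow> 'a \<Rightarrow> real \<Rightarrow> 'a set" where
  "clball M d \<equiv> Metric_space.mcball (space M) d"

definition regular_metric :: "'a measure \<Rightarrow> ('a \<Rightarrow> 'a \<Rightarrow> real) \<Rightarrow> bool" where
  "regular_metric M d \<longleftrightarrow>
     (\<forall>x\<in>space M. \<exists>c>0. \<forall>r>0. c * measure M (clball M d x r) \<le> measure M (oball M d x r))"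

text \<open>
  Only the implication from \<open>\<mu>(A) = 0\<close> to \<open>\<mu>(T\<^sup>-\<^sup>1A) = 0\<close> is required, so maps that are
  nonsingular in the two-sided sense are included.
\<close>

definition nonsingular_map :: "'a measure \<Rightarrow> ('a \<Rightarrow> 'a) \<Rightarrow> bool" where
  "nonsingular_map M T \<longleftrightarrow> T \<in> measurable M M \<and> absolutely_continuous M (distr M M T)"

text \<open>Negative natural logarithm, with \<open>-log 0 = +\<infinity>\<close> (whereas \<open>ln 0 = 0\<close> in the library).\<close>

definition neg_log :: "real \<Rightarrow> ereal" where
  "neg_log p = (if p = 0 then \<infinity> else ereal (- ln p))"

definition restricted_sensitive ::
    "'a measure \<Rightarrow> ('a \<Rightarrow> 'a \<Rightarrow> real) \<Rightarrow> ('a \<Rightarrow> 'a) \<Rightarrow> bool" where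
  "restricted_sensitive M d T \<longleftrightarrow>
     (AE x in M. \<exists>\<delta>>0. \<exists>a>0. \<forall>\<epsilon>>0. \<exists>n::nat.
        ereal (real n) \<le> ereal a * neg_log (measure M (oball M d x \<epsilon>)) \<and>
        measure M {y \<in> oball M d x \<epsilon>. d ((T ^^ n) x) ((T ^^ n) y) > \<delta>} > 0)"

definition restricted_pairwise_sensitive ::
    "'a measure \<Rightarrow> ('a \<Rightarrow> 'a \<Rightarrow> real) \<Rightarrow> ('a \<Rightarrow> 'a) \<Rightarrow> bool" where
  "restricted_pairwise_sensitive M d T \<longleftrightarrow>
     (\<exists>\<delta>>0. \<exists>a>0. AE (x, y) in M \<Otimes>\<^sub>M M. \<exists>n::nat.
        ereal (real n) \<le> ereal a * neg_log (measure M (oball M d x (d x y))) \<and>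
        d ((T ^^ n) x) ((T ^^ n) y) > \<delta>)"

end

theory Submission
  imports Defs
begin

text \<open>
  Fix a typical point \<open>x\<close>, a small ball \<open>B\<close> around it of measure \<open>p\<close>, and the regularity constant \<open>c\<close>
  of \<open>x\<close>.  Pairwise sensitivity separates almost every \<open>y\<close> from \<open>x\<close> within a time controlled by the
  measure of the ball of radius \<open>d x y\<close>, so the bound is useless for \<open>y\<close> very close to \<open>x\<close>.  Let \<open>s\<close> be the
  largest radius whose open ball has measure at most \<open>p / 2\<close>.  The closed ball of radius \<open>s\<close> has
  measure at least \<open>p / 2\<close>, and regularity lets the measure drop by at most the factor \<open>c\<close> from the closed
  to the open ball.  Hence the part of \<open>B\<close> outside the open ball of radius \<open>s\<close> is not null, and almost
  all its points are separated from \<open>x\<close> by a time at most \<open>- a ln (c p / 2)\<close>, which for \<open>p \<le> 1 / 2\<close> is at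
  most a fixed multiple of \<open>- ln p\<close>.  By countable additivity a single time within the bound separates
  a set of positive measure.  For \<open>p > 1 / 2\<close> the factor \<open>- ln p\<close> may be as small as \<open>0\<close>; then time
  \<open>0\<close> has to do, and it does once \<open>\<delta>\<close> is below a radius whose ball has measure at most
  \<open>1 / 4\<close>.

  This needs \<open>p > 0\<close> for every ball around almost every \<open>x\<close> (\<open>AE_ball_positive\<close>), and here the
  metric is tied to the standard topology only through the measurability of its open sets, so its
  separability is not at hand.  Any union of open null sets must be shown null.  Stone's proof that metric spaces are paracompact refines such a cover to countably many
  disjoint families of open null sets.  For each of these families, the map \<open>f\<close> sending a point to
  the index of its member has null fibres, while the preimage of \<^emph>\<open>every\<close> set of indices is open
  and so measurable.  On a standard space such a map has a null domain
  (\<open>standard_null_of_discrete_null_fibres\<close>).  Otherwise, with the space realised as a Borel subset of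
  the Polish space of real sequences and the indices as real numbers, the image measure is
  atomless, and composing \<open>f\<close> with its distribution function gives a map \<open>g\<close> with uniformly
  distributed values.  Let a Vitali set have translates \<open>V q\<close> by the rationals \<open>q\<close>; they cover the line,
  so \<open>g\<close> takes values in some \<open>V q\<close> with positive probability.  By inner regularity, applied to the
  graph of \<open>g\<close> over the preimage of \<open>V q\<close>, there is then a compact subset of \<open>V q\<close> of positive
  Lebesgue measure, which is impossible since it has infinitely many disjoint translates in a
  bounded set.
\<close>

section \<open>A decomposition of the real line\<close>

text \<open>
  The sets \<open>V q\<close> are the rational translates of a set of representatives of the reals modulo the
  rationals.  A compact \<open>C \<subseteq> V q\<close> is null because its translates by \<open>1 / (k + 1)\<close> are disjoint, have equal
  measure and stay in a bounded interval.
\<close>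

lemma Vitali_partition:
  obtains V :: "rat \<Rightarrow> real set"
  where "(\<Union>q. V q) = UNIV"
    and "\<And>q C. compact C \<Longrightarrow> C \<subseteq> V q \<Longrightarrow> emeasure lborel C = 0"
proof -
  define rep where "rep x = (SOME y. x - y \<in> \<rat>)" for x :: real
  have rep: "x - rep x \<in> \<rat>" for x
    unfolding rep_def by (rule someI[of _ x]) simp
  have rep_eq: "rep x = rep y" if "x - y \<in> \<rat>" for x y
  proof -
    have "x - z \<in> \<rat> \<longleftrightarrow> y - z \<in> \<rat>" for z
      using Rats_diff[OF _ that, of "x - z"] Rats_add[OF that, of "y - z"] by auto
    thus ?thesis unfolding rep_def by simp
  qed
  define V where "V q = {x. x - rep x = of_rat q}" for q
  have V_inj: "x = y" if "x \<in> V q" "y \<in> V q" "x - y \<in> \<rat>" for x y q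
    using that rep_eq[OF that(3)] unfolding V_def by auto
  show ?thesis
  proof
    show "(\<Union>q. V q) = UNIV"
      using rep unfolding V_def Rats_def by (auto simp: image_iff)
  next
    fix q C assume C: "compact C" "C \<subseteq> V q"
    define D where "D k = (+) (1 / real (Suc k)) ` C" for k
    have D_sets: "range D \<subseteq> sets lborel"
      using C(1) unfolding D_def by (auto intro!: borel_compact compact_translation)
    have D_disj: "disjoint_family D"
    unfolding disjoint_family_on_def
    proof (intro ballI impI equals0I)
      fix k l z assume "k \<noteq> l" and "z \<in> D k \<inter> D l"
      then obtain x y where xy: "x \<in> C" "y \<in> C" "z = 1 / real (Suc k) + x"
        "z = 1 / real (Suc l) + y"
        unfolding D_def by auto
      have "x - y = 1 / real (Suc l) - 1 / real (Suc k)" using xy by linarith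
      also have "\<dots> \<in> \<rat>" by (intro Rats_diff Rats_divide) auto
      finally have "x = y" using V_inj xy C(2) by blast
      hence "1 / real (Suc k) = 1 / real (Suc l)" using xy by linarith
      hence "k = l" by (simp add: frac_eq_eq)
      thus False using \<open>k \<noteq> l\<close> by simp
    qed
    obtain b where b: "\<And>x. x \<in> C \<Longrightarrow> \<bar>x\<bar> \<le> b"
      using compact_imp_bounded[OF C(1)] unfolding bounded_iff by auto
    have "(\<Union>k. D k) \<subseteq> {-b - 1..b + 1}"
    proof safe
      fix k z assume "z \<in> D k"
      then obtain x where x: "x \<in> C" "z = 1 / real (Suc k) + x" unfolding D_def by auto
      have "0 \<le> 1 / real (Suc k)" "1 / real (Suc k) \<le> 1" by auto
      thus "z \<in> {-b - 1..b + 1}" using b[OF x(1)] x(2) unfolding atLeastAtMost_iff by linarith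
    qed
    hence "emeasure lborel (\<Union>k. D k) \<le> emeasure lborel {-b - 1..b + 1}"
      by (rule emeasure_mono) simp
    hence fin: "emeasure lborel (\<Union>k. D k) \<noteq> \<infinity>"
      using emeasure_compact_finite[OF compact_Icc, of "- b - 1" "b + 1"] by (simp add: top_unique)
    have "(\<lambda>k. measure lborel (D k)) sums measure lborel (\<Union>k. D k)"
      by (rule measure_UNION[OF D_sets D_disj fin])
    moreover have "measure lborel (D k) = measure lborel C" for k
    proof -
      have image: "(\<lambda>x. x - 1 / real (Suc k)) -` C = (+) (1 / real (Suc k)) ` C"
        by force
      have "emeasure lborel (D k) = emeasure lborel C"
        using C(1) image unfolding D_def
        by (subst (2) lborel_affine[of 1 "- (1 / real (Suc k))"]) 
          (auto simp: emeasure_density emeasure_distr borel_compact nn_integral_distr)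
      thus ?thesis by (simp add: measure_def)
    qed
    ultimately have "summable (\<lambda>k::nat. measure lborel C)"
      by (simp add: sums_iff)
    hence "measure lborel C = 0" by (simp add: summable_const_iff)
    thus "emeasure lborel C = 0"
      using emeasure_compact_finite[OF C(1)]
      by (simp add: emeasure_eq_ennreal_measure)
  qed
qed

section \<open>Maps whose preimages are all measurable\<close>

lemma inner_regular_compact_witness:
  fixes M :: "'a::{second_countable_topology, complete_space} measure"
  assumes "sets M = sets borel" "emeasure M (space M) \<noteq> \<infinity>" "B \<in> sets borel" "emeasure M B \<noteq> 0"
  obtains K where "compact K" "K \<subseteq> B" "emeasure M K \<noteq> 0"
proof -
  have "(SUP K\<in>{K. K \<subseteq> B \<and> compact K}. emeasure M K) \<noteq> 0"
    using inner_regular[OF assms(1,2,3)] assms(4) by simp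
  then obtain K where "K \<subseteq> B" "compact K" "emeasure M K \<noteq> 0"
    by (auto simp: bot_ennreal[symmetric] SUP_bot_conv)
  thus ?thesis using that by blast
qed

text \<open>
  Through the injection \<open>j\<close> the distribution of \<open>h\<close> becomes a measure on the line, atomless as the
  fibres are null.  Composition with its distribution function makes the values uniform.  Were \<open>E\<close>
  not null, inner regularity would put a compact set of positive Lebesgue measure into every set of
  values that is taken with positive probability, and the decomposition of the line refutes that.
\<close>

lemma null_of_discrete_null_fibres:
  fixes M :: "'a::polish_space measure" and h :: "'a \<Rightarrow> 'b" and j :: "'b \<Rightarrow> real"
  assumes M: "finite_measure M" "sets M = sets borel"
    and meas: "\<And>A. {x \<in> E. h x \<in> A} \<in> sets M"
    and fibre: "\<And>t. emeasure M {x \<in> E. h x = t} = 0"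
    and inj: "inj_on j (h ` E)"
  shows "emeasure M E = 0"
proof (rule ccontr)
  assume pos: "emeasure M E \<noteq> 0"
  interpret M: finite_measure M by fact
  have sp: "space M = UNIV" using sets_eq_imp_space_eq[OF M(2)] by simp
  have E: "E \<in> sets M" using meas[of UNIV] by simp
  define N where "N = uniform_measure M E"
  have N: "emeasure N A = emeasure M (E \<inter> A) / emeasure M E" if "A \<in> sets M" for A
    unfolding N_def using E that by (rule emeasure_uniform_measure)
  have sN [simp]: "sets N = sets M" "space N = UNIV" unfolding N_def by (auto simp: sp)
  interpret N: prob_space N
    unfolding N_def using pos M.emeasure_finite[of E] by (intro prob_space_uniform_measure) auto
  \<comment> \<open>The value \<open>0\<close> off \<open>E\<close> has no effect, as \<open>N\<close> lives on \<open>E\<close>.\<close>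
  define f where "f x = (if x \<in> E then j (h x) else 0)" for x
  have f_meas: "f -` A \<in> sets M" for A
  proof -
    have "f -` A = {x \<in> E. h x \<in> j -` A} \<union> (if 0 \<in> A then UNIV - E else {})"
      unfolding f_def by (auto split: if_splits)
    thus ?thesis using meas[of "j -` A"] sets.compl_sets[OF E] by (auto simp: sp)
  qed
  have f_N: "f \<in> borel_measurable N"
    by (rule measurableI) (auto simp: f_meas)
  define D where "D = distr N borel f"
  interpret D: cdf_distribution D
    unfolding cdf_distribution_def D_def by (rule N.real_distribution_distr[OF f_N])
  have "emeasure D {t} = 0" for t
  proof -
    have "E \<inter> f -` {t} \<subseteq> {x \<in> E. h x = inv_into (h ` E) j t}"
      using inj unfolding f_def by (auto simp: inv_into_f_f)
    moreover have "{x \<in> E. h x = inv_into (h ` E) j t} \<in> sets M"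
      using meas[of "{inv_into (h ` E) j t}"] by simp
    ultimately have "emeasure M (E \<inter> f -` {t}) \<le> 0"
      using fibre[of "inv_into (h ` E) j t"] by (metis emeasure_mono)
    thus ?thesis unfolding D_def using N[OF f_meas[of "{t}"]]
      by (subst emeasure_distr[OF f_N]) auto
  qed
  hence cont: "isCont (cdf D) t" for t
    by (simp add: D.isCont_cdf measure_def)
  \<comment> \<open>\<open>D.I\<close> is the generalised inverse of the distribution function and carries the uniform
    distribution to \<open>D\<close>.  As there are no atoms, it is a right inverse, so the distribution function
    carries \<open>D\<close> back to the uniform distribution.\<close>
  have cdf_I: "cdf D (D.I \<omega>) = \<omega>" if "0 < \<omega>" "\<omega> < 1" for \<omega>
  proof (rule antisym)
    show "\<omega> \<le> cdf D (D.I \<omega>)" using D.pseudoinverse[OF that, of "D.I \<omega>"] by blast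
    have "cdf D x \<le> \<omega>" if "x < D.I \<omega>" for x
      by (rule less_imp_le, rule ccontr)
        (use D.pseudoinverse[OF \<open>0 < \<omega>\<close> \<open>\<omega> < 1\<close>, of x] that in \<open>meson not_less\<close>)
    hence "eventually (\<lambda>x. cdf D x \<le> \<omega>) (at_left (D.I \<omega>))"
      by (auto simp: eventually_at_filter)
    moreover have "(cdf D \<longlongrightarrow> cdf D (D.I \<omega>)) (at_left (D.I \<omega>))"
      using cont[of "D.I \<omega>"] filterlim_at_split unfolding isCont_def by blast
    ultimately show "cdf D (D.I \<omega>) \<le> \<omega>"
      by (intro tendsto_upperbound[of "cdf D" _ "at_left (D.I \<omega>)"]) auto
  qed
  define g where "g x = cdf D (f x)" for x
  have g_meas: "g -` A \<in> sets M" for A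
    using f_meas[of "cdf D -` A"] by (simp add: g_def vimage_def)
  have null: "emeasure M (E \<inter> g -` C) = 0" if C: "C \<in> sets borel" "emeasure lborel C = 0" for C
  proof -
    have CD: "cdf D -` C \<in> sets borel"
      using measurable_sets[OF D.measurable_C C(1)] by simp
    have "emeasure N (g -` C) = emeasure D (cdf D -` C)"
      unfolding D_def by (subst emeasure_distr[OF f_N]) (use CD in \<open>auto simp: D_def g_def vimage_def\<close>)
    also have "\<dots> = emeasure (distr (restrict_space lborel {0<..<1::real}) borel D.I) (cdf D -` C)"
      by (simp add: D.distr_I_eq_M)
    also have "\<dots> = emeasure (restrict_space lborel {0<..<1::real}) (D.I -` (cdf D -` C) \<inter> {0<..<1})"
      using CD D.measurable_CI
      by (subst emeasure_distr) (auto simp: space_restrict_space cong: measurable_cong_sets sets_restrict_space_cong)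
    also have "D.I -` (cdf D -` C) \<inter> {0<..<1} = C \<inter> {0<..<1}"
      using cdf_I by auto
    also have "emeasure (restrict_space lborel {0<..<1::real}) (C \<inter> {0<..<1}) =
        emeasure lborel (C \<inter> {0<..<1})"
      by (subst emeasure_restrict_space) auto
    also have "\<dots> \<le> emeasure lborel C" by (rule emeasure_mono) (use C in auto)
    finally have "emeasure M (E \<inter> g -` C) / emeasure M E = 0"
      using C(2) N[OF g_meas[of C]] by simp
    thus ?thesis using pos M.emeasure_finite[of E] by (auto simp: ennreal_divide_eq_0_iff)
  qed
  obtain V :: "rat \<Rightarrow> real set" where V: "(\<Union>q. V q) = UNIV"
      "\<And>q C. compact C \<Longrightarrow> C \<subseteq> V q \<Longrightarrow> emeasure lborel C = 0"
    using Vitali_partition by blast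
  have "\<exists>q. emeasure M (E \<inter> g -` V q) \<noteq> 0"
  proof (rule ccontr)
    assume "\<not> ?thesis"
    hence "emeasure M (\<Union>q. E \<inter> g -` V q) = 0"
      using E g_meas by (intro null_setsD1[OF null_sets_UN]) auto
    moreover have "(\<Union>q. E \<inter> g -` V q) = E"
      using V(1) by (simp flip: Int_UN_distrib vimage_UN)
    ultimately show False using pos by simp
  qed
  then obtain q where q: "emeasure M (E \<inter> g -` V q) \<noteq> 0" by blast
  define S where "S = E \<inter> g -` V q"
  have S: "S \<in> sets M" unfolding S_def using E g_meas by auto
  have gb: "g \<in> borel_measurable borel"
    by (rule measurableI) (use g_meas M(2) in auto)
  have G: "(\<lambda>x. (x, g x)) \<in> measurable M borel"
    using gb M(2) by (subst measurable_cong_sets[of M borel borel borel]) measurable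
  \<comment> \<open>\<open>g\<close> need not be continuous, so a compact subset of \<open>S\<close> could have a non-compact image.  A compact
    subset of the graph of \<open>g\<close> has a compact projection to the line.\<close>
  define K where "K = distr M borel (\<lambda>x. (x, g x))"
  define B where "B = {(x, t). x \<in> S \<and> t = g x}"
  have [measurable]: "S \<in> sets borel" "g \<in> borel_measurable borel"
    using S M(2) gb by auto
  have "{p \<in> space (borel \<Otimes>\<^sub>M borel). fst p \<in> S \<and> snd p = g (fst p)} \<in> sets (borel \<Otimes>\<^sub>M borel)"
    by measurable
  hence B: "B \<in> sets borel" unfolding B_def borel_prod by (simp add: case_prod_unfold)
  have K: "emeasure K A = emeasure M {x. (x, g x) \<in> A}" if "A \<in> sets borel" for A
    unfolding K_def by (subst emeasure_distr[OF G that]) (simp add: sp vimage_def)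
  have "emeasure K B = emeasure M S" unfolding K[OF B] by (simp add: B_def)
  hence KB: "emeasure K B \<noteq> 0" using q by (simp add: S_def)
  have K_fin: "emeasure K (space K) \<noteq> \<infinity>"
    using finite_measure.emeasure_finite[OF M.finite_measure_distr[OF G]] unfolding K_def by simp
  have "sets K = sets borel" unfolding K_def by simp
  then obtain L where L: "compact L" "L \<subseteq> B" "emeasure K L \<noteq> 0"
    using inner_regular_compact_witness[OF _ K_fin B KB] by blast
  have C: "compact (snd ` L)"
    by (rule compact_continuous_image[OF _ L(1)]) (intro continuous_intros)
  have "snd ` L \<subseteq> V q" using L(2) unfolding B_def S_def by auto
  hence "emeasure lborel (snd ` L) = 0" by (rule V(2)[OF C])
  hence "emeasure M (E \<inter> g -` (snd ` L)) = 0" using C by (intro null borel_compact)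
  moreover have "emeasure K L \<le> emeasure M (E \<inter> g -` (snd ` L))"
    unfolding K[OF borel_compact[OF L(1)]]
  proof (rule emeasure_mono)
    show "{x. (x, g x) \<in> L} \<subseteq> E \<inter> g -` (snd ` L)"
      using L(2) unfolding B_def S_def by force
  qed (use E g_meas in auto)
  ultimately show False using L(3) by simp
qed

section \<open>Standard spaces as Borel sets of real sequences\<close>

text \<open>
  A sequence is determined by the rational lower bounds of its entries, that is, by a subset of a
  countable set.
\<close>

lemma nat_fun_lepoll_real: "(UNIV :: (nat \<Rightarrow> real) set) \<lesssim> (UNIV :: real set)"
proof -
  define c :: "(nat \<Rightarrow> real) \<Rightarrow> nat set" where
    "c u = {m. of_rat (from_nat (snd (prod_decode m))) < u (fst (prod_decode m))}" for u
  have "inj c"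
  proof (rule injI, rule ext, rule ccontr)
    have le: "\<not> u n < v n" if "c u = c v" for u v n
    proof
      assume "u n < v n"
      then obtain r :: rat where r: "u n < of_rat r" "of_rat r < v n"
        using of_rat_dense by blast
      hence "prod_encode (n, to_nat r) \<in> c v" "prod_encode (n, to_nat r) \<notin> c u"
        unfolding c_def by auto
      thus False using that by simp
    qed
    fix u v n assume "c u = c v" "u n \<noteq> v n"
    thus False using le[of u v n] le[of v u n] by auto
  qed
  hence "(UNIV :: (nat \<Rightarrow> real) set) \<lesssim> (UNIV :: nat set set)"
    unfolding lepoll_def by auto
  thus ?thesis using lepoll_trans2 nat_sets_eqpoll_reals by blast
qed

text \<open>
  The distances to the points of a countable dense set embed a separable metric space into the
  sequence space.  Complete metrizability makes the image a G-delta set.  Being Borel, it lets the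
  images of all measurable sets be Borel as well.
\<close>

lemma standard_prob_space_embedding:
  fixes M :: "'a measure"
  assumes "standard_prob_space M"
  obtains \<Phi> :: "'a \<Rightarrow> nat \<Rightarrow> real"
  where "\<Phi> \<in> borel_measurable M" "inj_on \<Phi> (space M)"
    "\<And>S. S \<in> sets M \<Longrightarrow> \<Phi> ` S \<in> sets borel"
proof -
  interpret prob_space M using assms unfolding standard_prob_space_def by auto
  obtain \<tau> where \<tau>: "completely_metrizable_space \<tau>" "second_countable \<tau>" "topspace \<tau> = space M"
      "sets M = sigma_sets (space M) {U. openin \<tau> U}"
    using assms unfolding standard_prob_space_def by auto
  obtain X \<rho> where \<rho>: "Metric_space X \<rho>" "Metric_space.mcomplete X \<rho>"
      "\<tau> = Metric_space.mtopology X \<rho>"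
    using \<tau>(1) unfolding completely_metrizable_space_def by blast
  interpret R: Metric_space X \<rho> by fact
  have X: "X = space M" using \<tau>(3) \<rho>(3) by simp
  obtain D where D: "countable D" "D \<subseteq> X" "R.mtopology closure_of D = X"
    using second_countable_imp_separable_space[OF \<tau>(2)] \<rho>(3)
    unfolding separable_space_def by auto
  have "D \<noteq> {}" using D(3) X not_empty by auto
  define p where "p = from_nat_into D"
  have p: "range p = D" unfolding p_def using D(1) \<open>D \<noteq> {}\<close> by (rule range_from_nat_into[rotated])
  have pX: "p n \<in> X" for n using p D(2) by auto
  have dense: "\<exists>n. \<rho> x (p n) < e" if x: "x \<in> X" and e: "e > 0" for x e
  proof -
    have "x \<in> R.mtopology closure_of D" using D(3) x by simp
    then obtain y where "y \<in> D" "\<rho> x y < e"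
      using e unfolding R.metric_closure_of mem_Collect_eq R.in_mball by blast
    thus ?thesis using p by auto
  qed
  define \<Phi> where "\<Phi> x n = \<rho> x (p n)" for x n
  have sep: "\<rho> y x < e" if "x \<in> X" "y \<in> X" "\<rho> x (p n) < e / 2" "\<rho> y (p n) < e / 2" for x y n e
    using R.triangle[of y "p n" x] that pX by (auto simp: R.commute)
  have inj: "inj_on \<Phi> X"
  proof (rule inj_onI, rule ccontr)
    fix x y assume xy: "x \<in> X" "y \<in> X" "\<Phi> x = \<Phi> y" "x \<noteq> y"
    have "\<rho> x y > 0" using xy by simp
    then obtain n where n: "\<rho> x (p n) < \<rho> x y / 2" using dense[of x "\<rho> x y / 2"] xy by auto
    moreover have "\<rho> y (p n) < \<rho> x y / 2" using fun_cong[OF xy(3), of n] n unfolding \<Phi>_def by simp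
    ultimately show False using sep[of x y n "\<rho> x y"] xy by (simp add: R.commute)
  qed
  have open_image: "\<exists>W. open W \<and> \<Phi> ` U = \<Phi> ` X \<inter> W" if U: "openin R.mtopology U" for U
  proof -
    \<comment> \<open>A member of this union says that \<open>u\<close> is within \<open>e / 2\<close> of the dense point \<open>p n\<close>, which in turn is within
      \<open>e / 2\<close> of the centre \<open>x\<close> of a ball of radius \<open>e\<close> inside \<open>U\<close>.\<close>
    define W where "W = \<Union>{{u. u n < e / 2} | n e. \<exists>x. R.mball x e \<subseteq> U \<and> x \<in> X \<and> \<rho> x (p n) < e / 2}"
    have "open W" unfolding W_def
      by (intro open_Union) (auto intro!: open_Collect_less continuous_intros continuous_on_product_coordinates)
    moreover have "\<Phi> ` U \<subseteq> \<Phi> ` X \<inter> W"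
    proof safe
      fix x assume x: "x \<in> U"
      show xX: "\<Phi> x \<in> \<Phi> ` X" using U x openin_subset by fastforce
      have "x \<in> X" using U x openin_subset by fastforce
      obtain e where e: "e > 0" "R.mball x e \<subseteq> U" using U x unfolding R.openin_mtopology by blast
      obtain n where "\<rho> x (p n) < e / 2" using dense[OF \<open>x \<in> X\<close>, of "e / 2"] e by auto
      thus "\<Phi> x \<in> W" unfolding W_def \<Phi>_def using e \<open>x \<in> X\<close> by blast
    qed
    moreover have "\<Phi> ` X \<inter> W \<subseteq> \<Phi> ` U"
    proof safe
      fix y assume y: "\<Phi> y \<in> W" "y \<in> X"
      then obtain n e x where "R.mball x e \<subseteq> U" "x \<in> X" "\<rho> x (p n) < e / 2" "\<rho> y (p n) < e / 2"
        unfolding W_def \<Phi>_def by auto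
      thus "\<Phi> y \<in> \<Phi> ` U" using sep[of x y n e] y by (auto simp: R.in_mball R.commute)
    qed
    ultimately show ?thesis by blast
  qed
  have cont: "continuous_map R.mtopology euclidean \<Phi>"
  proof -
    have "continuous_map R.mtopology euclidean (\<lambda>x. \<rho> x (p n))" for n
      using continuous_on_mdist[of "p n" "metric (X, \<rho>)"] pX[of n]
      by (simp add: R.commute[of _ "p n"])
    thus ?thesis unfolding euclidean_product_topology[symmetric] \<Phi>_def
      by (auto simp: continuous_map_componentwise_UNIV)
  qed
  have "homeomorphic_map R.mtopology (subtopology euclidean (\<Phi> ` X)) \<Phi>"
  proof (rule bijective_open_imp_homeomorphic_map)
    show "continuous_map R.mtopology (subtopology euclidean (\<Phi> ` X)) \<Phi>"
      using cont by (auto simp: continuous_map_in_subtopology)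
    show "open_map R.mtopology (subtopology euclidean (\<Phi> ` X)) \<Phi>"
      unfolding open_map_def openin_subtopology using open_image by (metis inf_commute open_openin)
  qed (use inj in auto)
  hence "completely_metrizable_space (subtopology euclidean (\<Phi> ` X))"
    using homeomorphic_completely_metrizable_space homeomorphic_map_imp_homeomorphic_space \<tau>(1) \<rho>(3)
    by blast
  hence "gdelta_in euclidean (\<Phi> ` X)"
    by (rule completely_metrizable_space_imp_gdelta_in[rotated 2])
      (auto simp: metrizable_space_euclidean)
  then obtain F where F: "countable F" "F \<subseteq> {U. open U}" "\<Inter>F = \<Phi> ` X"
    unfolding gdelta_in_alt intersection_of_def by auto
  have E: "\<Phi> ` X \<in> sets borel"
  proof (cases "F = {}")
    case False
    have "(\<Inter>U\<in>F. U) \<in> sets borel"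
      using F(1,2) False by (intro sets.countable_INT') auto
    thus ?thesis using F(3) by simp
  qed (use F(3) in auto)
  have image: "\<Phi> ` S \<in> sets borel" if "S \<in> sets M" for S
    using that unfolding \<tau>(4)
  proof (induction S rule: sigma_sets.induct)
    case (Basic U)
    then obtain W where "open W" "\<Phi> ` U = \<Phi> ` X \<inter> W"
      using open_image[of U] \<rho>(3) by blast
    thus ?case using E by auto
  next
    case (Compl S)
    have "S \<subseteq> X" using Compl(1) X sigma_sets_into_sp[of "{U. openin \<tau> U}" "space M"]
        openin_subset[of \<tau>] \<tau>(3) by auto
    hence "\<Phi> ` (space M - S) = \<Phi> ` X - \<Phi> ` S" using inj X by (simp add: inj_on_image_set_diff)
    thus ?case using E Compl(2) by auto
  next
    case (Union S)
    thus ?case by (auto simp: image_UN)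
  qed auto
  have "\<Phi> \<in> borel_measurable M"
  proof (rule borel_measurableI)
    fix W :: "(nat \<Rightarrow> real) set" assume "open W"
    hence "openin \<tau> {x \<in> X. \<Phi> x \<in> W}"
      using openin_continuous_map_preimage[OF cont, of W] \<rho>(3) by simp
    hence "{x \<in> X. \<Phi> x \<in> W} \<in> sets M" unfolding \<tau>(4) by (intro sigma_sets.Basic) auto
    moreover have "\<Phi> -` W \<inter> space M = {x \<in> X. \<Phi> x \<in> W}" using X by auto
    ultimately show "\<Phi> -` W \<inter> space M \<in> sets M" by simp
  qed
  thus ?thesis using that[of \<Phi>] inj image X by simp
qed

text \<open>
  Arguments from cardinality alone fail here: relative to a measurable cardinal, it is consistent
  that the continuum carries an atomless probability defined on all its subsets.  Standardness
  excludes that such a probability is the distribution of \<open>f\<close>, because it makes the measure inner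
  regular with respect to compact sets.
\<close>

lemma standard_null_of_discrete_null_fibres:
  fixes M :: "'a measure" and f :: "'a \<Rightarrow> 'a"
  assumes M: "standard_prob_space M"
    and f: "\<And>x. x \<in> U \<Longrightarrow> f x \<in> space M"
    and meas: "\<And>A. {x \<in> U. f x \<in> A} \<in> sets M"
    and fibre: "\<And>t. emeasure M {x \<in> U. f x = t} = 0"
  shows "emeasure M U = 0"
proof -
  interpret prob_space M using M unfolding standard_prob_space_def by auto
  obtain \<Phi> :: "'a \<Rightarrow> nat \<Rightarrow> real" where \<Phi>: "\<Phi> \<in> borel_measurable M" "inj_on \<Phi> (space M)"
    "\<And>S. S \<in> sets M \<Longrightarrow> \<Phi> ` S \<in> sets borel"
    using standard_prob_space_embedding[OF M] by blast
  obtain j0 :: "(nat \<Rightarrow> real) \<Rightarrow> real" where j0: "inj j0"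
    using nat_fun_lepoll_real unfolding lepoll_def by auto
  have U: "U \<in> sets M" using meas[of UNIV] by simp
  hence U_sub: "U \<subseteq> space M" by (rule sets.sets_into_space)
  define h where "h u = f (inv_into (space M) \<Phi> u)" for u
  have h: "h (\<Phi> x) = f x" if "x \<in> U" for x
    using that U_sub \<Phi>(2) unfolding h_def by (simp add: inv_into_f_f subset_iff)
  have image: "{u \<in> \<Phi> ` U. h u \<in> A} = \<Phi> ` {x \<in> U. f x \<in> A}" for A
    using h by auto
  have pre: "emeasure (distr M borel \<Phi>) (\<Phi> ` S) = emeasure M S" if "S \<in> sets M" for S
  proof -
    have "\<Phi> -` \<Phi> ` S \<inter> space M = S"
      using sets.sets_into_space[OF that] \<Phi>(2) by (auto dest: inj_onD)
    thus ?thesis using \<Phi>(1) \<Phi>(3)[OF that] by (simp add: emeasure_distr)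
  qed
  have "emeasure (distr M borel \<Phi>) (\<Phi> ` U) = 0"
  proof (rule null_of_discrete_null_fibres[where h = h and j = "j0 \<circ> \<Phi>"])
    show "{u \<in> \<Phi> ` U. h u \<in> A} \<in> sets (distr M borel \<Phi>)" for A
      unfolding image using \<Phi>(3)[OF meas[of A]] by simp
    show "emeasure (distr M borel \<Phi>) {u \<in> \<Phi> ` U. h u = t} = 0" for t
      using image[of "{t}"] pre[OF meas[of "{t}"]] fibre[of t] by simp
    have "h ` \<Phi> ` U \<subseteq> space M" using h f by auto
    thus "inj_on (j0 \<circ> \<Phi>) (h ` \<Phi> ` U)"
      using \<Phi>(2) j0 by (meson comp_inj_on inj_on_subset subset_UNIV)
  qed (use finite_measure_distr[OF \<Phi>(1)] in auto)
  thus ?thesis using pre[OF U] by simp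
qed

section \<open>Unions of open null sets\<close>

text \<open>
  The family of open null sets may be uncountable, so countable additivity does not apply.  As in
  Stone's theorem, well-order the members and let \<open>E n y\<close> be the set of points that belong to the
  member \<open>G y\<close> with room \<open>2 / (n + 1)\<close> and to no earlier member.  For fixed \<open>n\<close>, the neighbourhoods of radius
  \<open>1 / (n + 1)\<close> of these sets are disjoint for different \<open>y\<close>, so they define a map to the indices all of
  whose preimages are open; its fibres lie in the null sets \<open>G y\<close>.
\<close>

lemma null_Union_open_null:
  fixes M :: "'a measure" and \<U> :: "'a set set"
  assumes M: "standard_prob_space M" and d: "measurable_metric M d"
    and op: "\<And>G. G \<in> \<U> \<Longrightarrow> openin (Metric_space.mtopology (space M) d) G"
    and null: "\<And>G. G \<in> \<U> \<Longrightarrow> emeasure M G = 0"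
  shows "emeasure M (\<Union>\<U>) = 0"
proof -
  interpret prob_space M using M unfolding standard_prob_space_def by auto
  interpret D: Metric_space "space M" d using d unfolding measurable_metric_def by auto
  have open_sets: "G \<in> sets M" if "openin D.mtopology G" for G
    using d that unfolding measurable_metric_def by auto
  obtain r :: "'a rel" where r: "well_order_on UNIV r" using well_order_on by blast
  have wf: "wf (r - Id)" using r unfolding well_order_on_def by simp
  have total: "(y, z) \<in> r - Id \<or> (z, y) \<in> r - Id" if "y \<noteq> z" for y z
    using r that unfolding well_order_on_def linear_order_on_def total_on_def by auto
  \<comment> \<open>Members are indexed by points of the space, which bounds the number of indices by the
    continuum.\<close>
  have "\<forall>y\<in>\<Union>\<U>. \<exists>G. G \<in> \<U> \<and> y \<in> G" by auto
  then obtain G where G: "\<And>y. y \<in> \<Union>\<U> \<Longrightarrow> G y \<in> \<U> \<and> y \<in> G y" by metis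
  define E where "E n y = {x \<in> space M. D.mball x (2 / real (Suc n)) \<subseteq> G y \<and>
      (\<forall>z\<in>\<Union>\<U>. (z, y) \<in> r - Id \<longrightarrow> x \<notin> G z)}" for n :: nat and y
  \<comment> \<open>The union of the neighbourhoods with index in \<open>A\<close>; below it is the preimage of \<open>A\<close> under \<open>f\<close>.\<close>
  define U where "U n A = (\<Union>y\<in>A \<inter> \<Union>\<U>. \<Union>x\<in>E n y. D.mball x (1 / real (Suc n)))" for n A
  have U_open: "openin D.mtopology (U n A)" for n A
    unfolding U_def by (intro openin_Union ballI) auto
  have disj: "\<not> (z, y) \<in> r - Id"
    if uy: "u \<in> U n {y}" and uz: "u \<in> U n {z}" for n u y z
  proof
    assume less: "(z, y) \<in> r - Id"
    obtain x where x: "x \<in> E n y" "u \<in> D.mball x (1 / real (Suc n))" "y \<in> \<Union>\<U>"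
      using uy unfolding U_def by blast
    obtain w where w: "w \<in> E n z" "u \<in> D.mball w (1 / real (Suc n))" "z \<in> \<Union>\<U>"
      using uz unfolding U_def by blast
    have "d w x \<le> d w u + d u x" using x w by (intro D.triangle) (auto simp: E_def)
    also have "\<dots> < 1 / real (Suc n) + 1 / real (Suc n)"
      using x(2) w(2) by (intro add_strict_mono) (auto simp: D.commute)
    finally have "d w x < 2 / real (Suc n)" by simp
    hence "x \<in> D.mball w (2 / real (Suc n))" using x w by (auto simp: E_def)
    hence "x \<in> G z" using w(1) by (auto simp: E_def)
    thus False using x(1) w(3) less by (auto simp: E_def)
  qed
  have U_null: "emeasure M (U n UNIV) = 0" for n
  proof -
    define f where "f u = (SOME y. u \<in> U n {y})" for u
    have f: "u \<in> U n {f u}" if "u \<in> U n UNIV" for u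
      unfolding f_def by (rule someI_ex) (use that in \<open>auto simp: U_def\<close>)
    have f_eq: "f u = y" if "u \<in> U n {y}" for u y
    proof (rule ccontr)
      assume "f u \<noteq> y"
      have "u \<in> U n {f u}" using that unfolding f_def by (rule someI)
      thus False using total[OF \<open>f u \<noteq> y\<close>] disj that by blast
    qed
    have U_point: "u \<in> U n A \<longleftrightarrow> (\<exists>y\<in>A. u \<in> U n {y})" for u A
      unfolding U_def by auto
    have pre: "{u \<in> U n UNIV. f u \<in> A} = U n A" for A
    proof (intro set_eqI iffI)
      fix u assume "u \<in> {u \<in> U n UNIV. f u \<in> A}"
      thus "u \<in> U n A" using f[of u] U_point[of u A] by blast
    next
      fix u assume "u \<in> U n A"
      then obtain y where "y \<in> A" "u \<in> U n {y}" using U_point[of u A] by blast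
      thus "u \<in> {u \<in> U n UNIV. f u \<in> A}" using f_eq[of u y] U_point[of u UNIV] by blast
    qed
    show ?thesis
    proof (rule standard_null_of_discrete_null_fibres[OF M, where f = f])
      show "f u \<in> space M" if "u \<in> U n UNIV" for u
      proof -
        have "f u \<in> \<Union>\<U>" using f[OF that] unfolding U_def by auto
        thus ?thesis using op openin_subset by fastforce
      qed
      show "{u \<in> U n UNIV. f u \<in> A} \<in> sets M" for A
        unfolding pre by (rule open_sets[OF U_open])
      show "emeasure M {u \<in> U n UNIV. f u = t} = 0" for t
      proof (cases "t \<in> \<Union>\<U>")
        case True
        have "U n {t} \<subseteq> G t"
        proof
          fix u assume "u \<in> U n {t}"
          then obtain x where x: "x \<in> E n t" "u \<in> D.mball x (1 / real (Suc n))"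
            unfolding U_def by blast
          have "D.mball x (1 / real (Suc n)) \<subseteq> D.mball x (2 / real (Suc n))"
            by (rule D.mball_subset_concentric) (simp add: divide_simps)
          thus "u \<in> G t" using x by (auto simp: E_def)
        qed
        hence "emeasure M (U n {t}) \<le> emeasure M (G t)"
          using op G[OF True] by (intro emeasure_mono open_sets) auto
        thus ?thesis using pre[of "{t}"] null G[OF True] by auto
      next
        case False
        hence "U n {t} = {}" unfolding U_def by auto
        hence "{u \<in> U n UNIV. f u = t} = {}" using pre[of "{t}"] by blast
        thus ?thesis by (simp only: emeasure_empty)
      qed
    qed
  qed
  have "\<Union>\<U> \<subseteq> (\<Union>n. U n UNIV)"
  proof
    fix x assume x: "x \<in> \<Union>\<U>"
    \<comment> \<open>The least index of a member containing \<open>x\<close> places \<open>x\<close> in some \<open>E n y\<close>.\<close>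
    define Q where "Q = {y \<in> \<Union>\<U>. x \<in> G y}"
    have "x \<in> Q" using x G unfolding Q_def by auto
    then obtain y where y: "y \<in> Q" "\<And>z. (z, y) \<in> r - Id \<Longrightarrow> z \<notin> Q"
      using wfE_min[OF wf] by metis
    have "openin D.mtopology (G y)" "x \<in> G y" using y(1) op G unfolding Q_def by auto
    then obtain e where e: "e > 0" "D.mball x e \<subseteq> G y" "x \<in> space M"
      unfolding D.openin_mtopology by blast
    obtain n where n: "2 / e < real (Suc n)"
      using reals_Archimedean2 less_trans[OF _ of_nat_less_iff[THEN iffD2, OF lessI]] by blast
    hence "2 / real (Suc n) \<le> e" using e(1) by (simp add: field_simps)
    hence "x \<in> E n y" using e y D.mball_subset_concentric[of "2 / real (Suc n)" e x]
      unfolding E_def Q_def by blast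
    moreover have "x \<in> D.mball x (1 / real (Suc n))" using e(3) by simp
    moreover have "y \<in> \<Union>\<U>" using y(1) unfolding Q_def by simp
    ultimately have "x \<in> U n UNIV" unfolding U_def by blast
    thus "x \<in> (\<Union>n. U n UNIV)" by blast
  qed
  moreover have "emeasure M (\<Union>n. U n UNIV) = 0"
    using U_null open_sets[OF U_open] by (intro null_setsD1[OF null_sets_UN]) auto
  ultimately show ?thesis
    using emeasure_mono[of "\<Union>\<U>" "\<Union>n. U n UNIV" M] open_sets[OF U_open] by auto
qed

lemma AE_ball_positive:
  assumes M: "standard_prob_space M" and d: "measurable_metric M d"
  shows "AE x in M. \<forall>r>0. measure M (oball M d x r) > 0"
proof -
  interpret prob_space M using M unfolding standard_prob_space_def by auto
  interpret D: Metric_space "space M" d using d unfolding measurable_metric_def by auto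
  define \<U> where "\<U> = {G. openin D.mtopology G \<and> emeasure M G = 0}"
  have "openin D.mtopology (\<Union>\<U>)" unfolding \<U>_def by auto
  hence "\<Union>\<U> \<in> sets M" using d unfolding measurable_metric_def by auto
  moreover have "emeasure M (\<Union>\<U>) = 0"
    by (rule null_Union_open_null[OF M d]) (auto simp: \<U>_def)
  ultimately have "\<Union>\<U> \<in> null_sets M" by auto
  moreover have "{x \<in> space M. \<not> (\<forall>r>0. measure M (D.mball x r) > 0)} \<subseteq> \<Union>\<U>"
  proof
    fix x assume "x \<in> {x \<in> space M. \<not> (\<forall>r>0. measure M (D.mball x r) > 0)}"
    then obtain r where x: "x \<in> space M" "0 < r" "\<not> measure M (D.mball x r) > 0"
      by blast
    hence "measure M (D.mball x r) = 0" using measure_nonneg[of M "D.mball x r"] by linarith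
    hence "D.mball x r \<in> \<U>" unfolding \<U>_def by (simp add: emeasure_eq_measure)
    moreover have "x \<in> D.mball x r" using x by simp
    ultimately show "x \<in> \<Union>\<U>" by blast
  qed
  ultimately show ?thesis by (rule AE_I')
qed

section \<open>Sensitivity\<close>

text \<open>
  The radius \<open>s\<close> is the supremum of the radii whose open ball has at most half the measure of the
  given ball.  Continuity from below keeps the open ball of radius \<open>s\<close> within that half; continuity
  from above gives the closed ball of radius \<open>s\<close> at least that half, and regularity passes this on
  to the open ball up to the factor \<open>c\<close>.
\<close>

lemma regular_half_measure_radius:
  fixes M :: "'a measure" and d :: "'a \<Rightarrow> 'a \<Rightarrow> real"
  assumes "finite_measure M" and "Metric_space (space M) d"
    and meas: "\<And>r. oball M d x r \<in> sets M" "\<And>r. clball M d x r \<in> sets M"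
    and x: "x \<in> space M"
    and small: "\<And>e. 0 < e \<Longrightarrow> \<exists>r>0. measure M (oball M d x r) \<le> e"
    and c: "0 < c" "\<And>r. r > 0 \<Longrightarrow> c * measure M (clball M d x r) \<le> measure M (oball M d x r)"
    and eps: "measure M (oball M d x \<epsilon>) > 0"
  obtains s where "c * (measure M (oball M d x \<epsilon>) / 2) \<le> measure M (oball M d x s)"
    "measure M (oball M d x s) \<le> measure M (oball M d x \<epsilon>) / 2"
proof -
  interpret finite_measure M by fact
  interpret D: Metric_space "space M" d by fact
  define m where "m r = measure M (D.mball x r)" for r
  have m_mono: "m r \<le> m s" if "r \<le> s" for r s
    unfolding m_def using D.mball_subset_concentric[OF that] meas by (intro finite_measure_mono) auto
  define p where "p = m \<epsilon>"
  have p: "p > 0" using eps unfolding p_def m_def .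
  define R where "R = {r. 0 < r \<and> m r \<le> p / 2}"
  have R_less: "r < \<epsilon>" if "r \<in> R" for r
    using that m_mono[of \<epsilon> r] p unfolding R_def p_def by force
  obtain r0 where r0: "r0 \<in> R" using small[of "p / 2"] p unfolding R_def m_def by auto
  have bdd: "bdd_above R" using R_less by (intro bdd_aboveI[of _ \<epsilon>]) (auto intro: less_imp_le)
  define s where "s = Sup R"
  have "r0 \<le> s" unfolding s_def using r0 bdd by (rule cSup_upper)
  hence s_pos: "s > 0" using r0 unfolding R_def by auto
  have below: "m r \<le> p / 2" if "r < s" for r
  proof -
    obtain r' where "r' \<in> R" "r < r'"
      using \<open>r < s\<close> less_cSup_iff[OF _ bdd, of r] r0 unfolding s_def by auto
    thus ?thesis using m_mono[of r r'] unfolding R_def by auto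
  qed
  have above: "m r > p / 2" if "s < r" for r
  proof (rule ccontr)
    assume "\<not> m r > p / 2"
    hence "r \<in> R" using that s_pos unfolding R_def by auto
    hence "r \<le> s" unfolding s_def using bdd by (rule cSup_upper)
    thus False using that by simp
  qed
  have inv0: "(\<lambda>n. 1 / real (Suc n)) \<longlonglongrightarrow> 0"
    by (rule LIMSEQ_Suc[OF lim_1_over_n])
  have "m s \<le> p / 2"
  proof -
    have "(\<lambda>n. m (s - 1 / real (Suc n))) \<longlonglongrightarrow> measure M (\<Union>n. D.mball x (s - 1 / real (Suc n)))"
      unfolding m_def
      by (rule finite_Lim_measure_incseq)
        (use meas in \<open>auto simp: incseq_def intro!: D.mball_subset_concentric frac_le\<close>)
    moreover have "(\<Union>n. D.mball x (s - 1 / real (Suc n))) = D.mball x s"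
    proof (intro equalityI subsetI)
      fix y assume y: "y \<in> D.mball x s"
      hence "eventually (\<lambda>n. 1 / real (Suc n) < s - d x y) sequentially"
        by (intro order_tendstoD(2)[OF inv0]) auto
      then obtain n where "1 / real (Suc n) < s - d x y"
        using eventually_happens'[OF sequentially_bot] by blast
      thus "y \<in> (\<Union>n. D.mball x (s - 1 / real (Suc n)))" using y by (auto intro!: exI[of _ n])
    next
      fix y assume "y \<in> (\<Union>n. D.mball x (s - 1 / real (Suc n)))"
      then obtain n where "y \<in> D.mball x (s - 1 / real (Suc n))" by blast
      thus "y \<in> D.mball x s"
        using D.mball_subset_concentric[of "s - 1 / real (Suc n)" s x] by auto
    qed
    ultimately have "(\<lambda>n. m (s - 1 / real (Suc n))) \<longlonglongrightarrow> m s" by (simp add: m_def)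
    moreover have "m (s - 1 / real (Suc n)) \<le> p / 2" for n by (rule below) simp
    ultimately show ?thesis by (intro LIMSEQ_le_const2[of _ "m s"]) auto
  qed
  moreover have "p / 2 \<le> measure M (D.mcball x s)"
  proof -
    have "(\<lambda>n. m (s + 1 / real (Suc n))) \<longlonglongrightarrow> measure M (\<Inter>n. D.mball x (s + 1 / real (Suc n)))"
      unfolding m_def
      by (rule finite_Lim_measure_decseq)
        (use meas in \<open>auto simp: decseq_def intro!: D.mball_subset_concentric frac_le\<close>)
    moreover have "(\<Inter>n. D.mball x (s + 1 / real (Suc n))) = D.mcball x s"
    proof (intro equalityI subsetI)
      fix y assume y: "y \<in> (\<Inter>n. D.mball x (s + 1 / real (Suc n)))"
      hence *: "y \<in> D.mball x (s + 1 / real (Suc n))" for n by blast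
      have "(\<lambda>n. s + 1 / real (Suc n)) \<longlonglongrightarrow> s + 0" by (intro tendsto_intros inv0)
      moreover have "d x y \<le> s + 1 / real (Suc n)" for n using *[of n] unfolding D.in_mball by linarith
      ultimately have "d x y \<le> s + 0" by (intro LIMSEQ_le_const) auto
      thus "y \<in> D.mcball x s" using *[of 0] by auto
    next
      fix y assume "y \<in> D.mcball x s"
      thus "y \<in> (\<Inter>n. D.mball x (s + 1 / real (Suc n)))"
        by (auto intro: le_less_trans)
    qed
    ultimately have "(\<lambda>n. m (s + 1 / real (Suc n))) \<longlonglongrightarrow> measure M (D.mcball x s)" by simp
    moreover have "p / 2 \<le> m (s + 1 / real (Suc n))" for n by (rule less_imp_le[OF above]) simp
    ultimately show ?thesis by (intro LIMSEQ_le_const) auto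
  qed
  hence "c * (p / 2) \<le> m s"
    using c(2)[OF s_pos] c(1) mult_left_mono[of "p / 2" "measure M (D.mcball x s)" c]
    unfolding m_def by linarith
  ultimately show ?thesis using that[of s] unfolding p_def m_def by blast
qed

text \<open>
  The new constant is \<open>a' = a (1 + ln (2 / c) / ln 2)\<close>: for \<open>p \<le> 1 / 2\<close> the term \<open>ln (2 / c)\<close> in
  \<open>- ln (c p / 2) = - ln p + ln (2 / c)\<close> is at most \<open>ln (2 / c) / ln 2\<close> times \<open>- ln p\<close>.  Neither \<open>a'\<close> nor \<open>\<delta>'\<close>
  depends on \<open>\<epsilon>\<close>, but both depend on \<open>x\<close>.
\<close>

theorem proposition2p5:
  fixes M :: "'a measure" and d :: "'a \<Rightarrow> 'a \<Rightarrow> real" and T :: "'a \<Rightarrow> 'a"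
  assumes "standard_prob_space M"
    and "measurable_metric M d"
    and "regular_metric M d"
    and "nonsingular_map M T"
    and "restricted_pairwise_sensitive M d T"
  shows "restricted_sensitive M d T"
proof -
  interpret prob_space M using assms(1) unfolding standard_prob_space_def by auto
  interpret D: Metric_space "space M" d using assms(2) unfolding measurable_metric_def by auto
  have open_sets: "G \<in> sets M" if "openin D.mtopology G" for G
    using assms(2) that unfolding measurable_metric_def by auto
  have closed_sets: "G \<in> sets M" if G: "closedin D.mtopology G" for G
  proof -
    have "space M - G \<in> sets M" using G by (intro open_sets) (auto simp: closedin_def)
    moreover have "G = space M - (space M - G)" using closedin_subset[OF G] by auto
    ultimately show ?thesis by (metis sets.compl_sets)
  qed
  have mball: "D.mball x r \<in> sets M" and mcball: "D.mcball x r \<in> sets M" for x r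
    by (rule open_sets, simp) (rule closed_sets, simp)
  have T: "T \<in> measurable M M" using assms(4) unfolding nonsingular_map_def by auto
  have Tn [measurable]: "(T ^^ n) \<in> measurable M M" for n
    by (induction n) (use T in \<open>auto intro: measurable_comp\<close>)
  have Tn_in: "(T ^^ n) y \<in> space M" if "y \<in> space M" for n y
    using measurable_space[OF Tn that] .
  have d_meas: "(\<lambda>y. d z ((T ^^ n) y)) \<in> borel_measurable M" if "z \<in> space M" for z n
  proof -
    have "(\<lambda>y. (z, (T ^^ n) y)) \<in> measurable M (M \<Otimes>\<^sub>M M)" using that by measurable
    moreover have "(\<lambda>(x, y). d x y) \<in> borel_measurable (M \<Otimes>\<^sub>M M)"
      using assms(2) unfolding measurable_metric_def by auto
    ultimately have "(\<lambda>(x, y). d x y) \<circ> (\<lambda>y. (z, (T ^^ n) y)) \<in> borel_measurable M"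
      by (rule measurable_comp)
    thus ?thesis by (simp add: o_def)
  qed
  obtain \<delta> a where \<delta>: "\<delta> > 0" and a: "a > 0" and pairs: "AE (x, y) in M \<Otimes>\<^sub>M M. \<exists>n::nat.
        ereal (real n) \<le> ereal a * neg_log (measure M (oball M d x (d x y))) \<and>
        d ((T ^^ n) x) ((T ^^ n) y) > \<delta>"
    using assms(5) unfolding restricted_pairwise_sensitive_def by auto
  interpret P: pair_sigma_finite M M ..
  have "AE x in M. AE y in M. \<exists>n::nat.
        ereal (real n) \<le> ereal a * neg_log (measure M (oball M d x (d x y))) \<and>
        d ((T ^^ n) x) ((T ^^ n) y) > \<delta>"
    using P.AE_pair[OF pairs] by simp
  thus ?thesis
    using AE_ball_positive[OF assms(1,2)] AE_space unfolding restricted_sensitive_def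
  proof eventually_elim
    fix x
    assume ae: "AE y in M. \<exists>n::nat.
        ereal (real n) \<le> ereal a * neg_log (measure M (oball M d x (d x y))) \<and>
        d ((T ^^ n) x) ((T ^^ n) y) > \<delta>"
      and pos: "\<forall>r>0. measure M (oball M d x r) > 0" and x: "x \<in> space M"
    define m where "m r = measure M (D.mball x r)" for r
    \<comment> \<open>An atom \<open>x\<close> would be a possible \<open>y\<close>, but \<open>x\<close> is never separated from itself.\<close>
    have "D.mcball x 0 = {x}"
    proof (intro equalityI subsetI)
      fix y assume "y \<in> D.mcball x 0"
      thus "y \<in> {x}" using D.nonneg[of x y] D.zero[of x y] by auto
    qed (use x in auto)
    hence x_sets: "{x} \<in> sets M" using mcball[of x 0] by simp
    have "AE y in M. y \<notin> {x}"
      using ae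
    proof eventually_elim
      case (elim y)
      then obtain n where "d ((T ^^ n) x) ((T ^^ n) y) > \<delta>" by blast
      thus ?case using \<delta> D.mdist_zero[OF Tn_in[OF x, of n]] by auto
    qed
    hence "{x} \<in> null_sets M" using x_sets by (simp only: AE_iff_null_sets)
    hence point: "measure M {x} = 0" by (simp add: measure_def null_sets_def)
    have inv0: "(\<lambda>n. 1 / real (Suc n)) \<longlonglongrightarrow> 0" by (rule LIMSEQ_Suc[OF lim_1_over_n])
    have small: "\<exists>r>0. m r \<le> e" if e: "e > 0" for e
    proof -
      have "(\<lambda>n. m (1 / real (Suc n))) \<longlonglongrightarrow> measure M (\<Inter>n. D.mball x (1 / real (Suc n)))"
        unfolding m_def
        by (rule finite_Lim_measure_decseq)
          (use mball in \<open>auto simp: decseq_def intro!: D.mball_subset_concentric frac_le\<close>)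
      moreover have "(\<Inter>n. D.mball x (1 / real (Suc n))) = {x}"
      proof (intro equalityI subsetI)
        fix y assume "y \<in> (\<Inter>n. D.mball x (1 / real (Suc n)))"
        hence *: "y \<in> D.mball x (1 / real (Suc n))" for n by blast
        have "d x y \<le> 1 / real (Suc n)" for n using *[of n] unfolding D.in_mball by linarith
        hence "d x y \<le> 0" using inv0 by (intro LIMSEQ_le_const) auto
        moreover have y: "y \<in> space M" using *[of 0] by auto
        ultimately show "y \<in> {x}" using D.nonneg[of x y] x by auto
      qed (use x in auto)
      ultimately have "(\<lambda>n. m (1 / real (Suc n))) \<longlonglongrightarrow> 0" using point by simp
      hence "eventually (\<lambda>n. m (1 / real (Suc n)) < e) sequentially"
        using e by (rule order_tendstoD(2))
      then obtain n where "m (1 / real (Suc n)) < e"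
        using eventually_happens'[OF sequentially_bot] by blast
      thus ?thesis by (intro exI[of _ "1 / real (Suc n)"]) auto
    qed
    obtain c0 where c0: "c0 > 0" "\<And>r. r > 0 \<Longrightarrow> c0 * measure M (D.mcball x r) \<le> measure M (D.mball x r)"
      using assms(3) x unfolding regular_metric_def by blast
    \<comment> \<open>The bound \<open>c \<le> 1\<close> makes \<open>ln (2 / c)\<close> nonnegative.\<close>
    define c where "c = min c0 1"
    have c: "c > 0" "c \<le> 1" "\<And>r. r > 0 \<Longrightarrow> c * measure M (D.mcball x r) \<le> measure M (D.mball x r)"
    proof -
      fix r :: real assume "r > 0"
      have "c * measure M (D.mcball x r) \<le> c0 * measure M (D.mcball x r)"
        unfolding c_def by (intro mult_right_mono) auto
      thus "c * measure M (D.mcball x r) \<le> measure M (D.mball x r)" using c0(2)[OF \<open>r > 0\<close>] by simp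
    qed (use c0 in \<open>auto simp: c_def\<close>)
    obtain r1 where r1: "r1 > 0" "m r1 \<le> 1 / 4" using small[of "1 / 4"] by auto
    define \<delta>' where "\<delta>' = min \<delta> (r1 / 2)"
    define a' where "a' = a * (1 + ln (2 / c) / ln 2)"
    have "ln (2 / c) \<ge> 0" using c by simp
    hence a': "a' > 0" unfolding a'_def using a by (intro mult_pos_pos add_pos_nonneg) auto
    have "\<exists>n::nat. ereal (real n) \<le> ereal a' * neg_log (measure M (D.mball x \<epsilon>)) \<and>
        measure M {y \<in> D.mball x \<epsilon>. d ((T ^^ n) x) ((T ^^ n) y) > \<delta>'} > 0" if \<epsilon>: "\<epsilon> > 0" for \<epsilon>
    proof -
      define p where "p = m \<epsilon>"
      have p: "0 < p" "p \<le> 1" using pos \<epsilon> unfolding p_def m_def by auto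
      have Z_meas: "{y \<in> D.mball x \<epsilon>. d ((T ^^ n) x) ((T ^^ n) y) > e} \<in> sets M" for n e
      proof -
        have "{y \<in> space M. d ((T ^^ n) x) ((T ^^ n) y) > e} \<in> sets M"
          using d_meas[OF Tn_in[OF x]] by measurable
        hence "D.mball x \<epsilon> \<inter> {y \<in> space M. d ((T ^^ n) x) ((T ^^ n) y) > e} \<in> sets M"
          using mball by auto
        moreover have "D.mball x \<epsilon> \<inter> {y \<in> space M. d ((T ^^ n) x) ((T ^^ n) y) > e} =
            {y \<in> D.mball x \<epsilon>. d ((T ^^ n) x) ((T ^^ n) y) > e}" by auto
        ultimately show ?thesis by simp
      qed
      have neg_log_p: "neg_log (measure M (D.mball x \<epsilon>)) = ereal (- ln p)"
        using p unfolding neg_log_def p_def m_def by simp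
      \<comment> \<open>The estimate \<open>ln 2 \<le> - ln p\<close> in the second case absorbs the additive constant \<open>ln (2 / c)\<close>.\<close>
      show ?thesis
      proof (cases "p > 1 / 2")
        case True
        have "D.mball x \<epsilon> - D.mball x r1 \<subseteq> {y \<in> D.mball x \<epsilon>. d ((T ^^ 0) x) ((T ^^ 0) y) > \<delta>'}"
          using x r1(1) unfolding \<delta>'_def by auto
        hence "measure M (D.mball x \<epsilon> - D.mball x r1) \<le>
            measure M {y \<in> D.mball x \<epsilon>. d ((T ^^ 0) x) ((T ^^ 0) y) > \<delta>'}"
          by (intro finite_measure_mono Z_meas)
        moreover have "measure M (D.mball x \<epsilon>) \<le>
            measure M (D.mball x \<epsilon> - D.mball x r1) + measure M (D.mball x r1)"
          using measure_Un_le[of "D.mball x \<epsilon> - D.mball x r1" M "D.mball x r1"] mball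
            finite_measure_mono[of "D.mball x \<epsilon>" "D.mball x \<epsilon> - D.mball x r1 \<union> D.mball x r1"]
          by auto
        ultimately have "measure M {y \<in> D.mball x \<epsilon>. d ((T ^^ 0) x) ((T ^^ 0) y) > \<delta>'} > 0"
          using True r1(2) unfolding p_def m_def by linarith
        moreover have "ereal (real 0) \<le> ereal a' * neg_log (measure M (D.mball x \<epsilon>))"
          unfolding neg_log_p using a' p by (simp add: mult_nonneg_nonpos)
        ultimately show ?thesis by blast
      next
        case False
        obtain s where s: "c * (p / 2) \<le> m s" "m s \<le> p / 2"
          using regular_half_measure_radius[OF finite_measure_axioms D.Metric_space_axioms mball mcball x
              small[unfolded m_def] c(1,3), of \<epsilon>] p(1) unfolding p_def m_def by blast
        define B where "B = D.mball x \<epsilon> - D.mball x s"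
        have B: "B \<in> sets M" unfolding B_def using mball by auto
        have "measure M (D.mball x \<epsilon>) \<le> measure M B + measure M (D.mball x s)"
          using measure_Un_le[of B M "D.mball x s"] mball B
            finite_measure_mono[of "D.mball x \<epsilon>" "B \<union> D.mball x s"] unfolding B_def by auto
        hence B_pos: "measure M B > 0" using s(2) p(1) unfolding p_def m_def by linarith
        have bound: "ereal (real n) \<le> ereal a' * neg_log (measure M (D.mball x \<epsilon>))"
          if y: "y \<in> B" and n: "ereal (real n) \<le> ereal a * neg_log (measure M (D.mball x (d x y)))"
          for y n
        proof -
          have "s \<le> d x y" using y x unfolding B_def by auto
          hence "m s \<le> m (d x y)" unfolding m_def using mball D.mball_subset_concentric
            by (intro finite_measure_mono) auto
          hence q: "c * (p / 2) \<le> m (d x y)" using s(1) by linarith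
          have cp: "0 < c * (p / 2)" using c(1) p(1) by simp
          have "real n \<le> a * (- ln (m (d x y)))"
            using n q cp unfolding neg_log_def m_def by (simp split: if_splits)
          also have "\<dots> \<le> a * (- ln (c * (p / 2)))"
            using a q cp by (intro mult_left_mono) auto
          also have "- ln (c * (p / 2)) = - ln p + ln (2 / c)"
            using c(1) p(1) by (simp add: ln_mult ln_div)
          also have "ln (2 / c) \<le> ln (2 / c) / ln 2 * (- ln p)"
          proof -
            have "ln p \<le> ln (1 / 2)" using False p(1) by (subst ln_le_cancel_iff) auto
            hence "1 \<le> - ln p / ln 2" by (simp add: ln_div field_simps)
            hence "ln (2 / c) * 1 \<le> ln (2 / c) * (- ln p / ln 2)"
              using \<open>ln (2 / c) \<ge> 0\<close> by (rule mult_left_mono)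
            thus ?thesis by simp
          qed
          finally have "real n \<le> a' * (- ln p)"
            using a unfolding a'_def by (simp add: algebra_simps)
          thus ?thesis unfolding neg_log_p by simp
        qed
        have "\<exists>n. ereal (real n) \<le> ereal a' * neg_log (measure M (D.mball x \<epsilon>)) \<and>
          measure M {y \<in> D.mball x \<epsilon>. d ((T ^^ n) x) ((T ^^ n) y) > \<delta>'} \<noteq> 0"
        proof (rule ccontr)
          assume none: "\<not> ?thesis"
          have "AE y in M. ereal (real n) \<le> ereal a' * neg_log (measure M (D.mball x \<epsilon>)) \<longrightarrow>
            y \<notin> {y \<in> D.mball x \<epsilon>. d ((T ^^ n) x) ((T ^^ n) y) > \<delta>'}" for n
          proof (cases "ereal (real n) \<le> ereal a' * neg_log (measure M (D.mball x \<epsilon>))")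
            case True
            hence "{y \<in> D.mball x \<epsilon>. d ((T ^^ n) x) ((T ^^ n) y) > \<delta>'} \<in> null_sets M"
              using none Z_meas by (auto simp: emeasure_eq_measure)
            thus ?thesis using AE_not_in by force
          qed simp
          hence "AE y in M. \<forall>n. ereal (real n) \<le> ereal a' * neg_log (measure M (D.mball x \<epsilon>)) \<longrightarrow>
            y \<notin> {y \<in> D.mball x \<epsilon>. d ((T ^^ n) x) ((T ^^ n) y) > \<delta>'}"
            by (simp only: AE_all_countable) simp
          hence "AE y in M. y \<notin> B"
            using ae
          proof eventually_elim
            case (elim y)
            show ?case
            proof
              assume y: "y \<in> B"
              obtain n where n: "ereal (real n) \<le> ereal a * neg_log (measure M (D.mball x (d x y)))"
                "d ((T ^^ n) x) ((T ^^ n) y) > \<delta>" using elim(2) by blast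
              have "y \<in> {y \<in> D.mball x \<epsilon>. d ((T ^^ n) x) ((T ^^ n) y) > \<delta>'}"
                using y n(2) unfolding B_def \<delta>'_def by auto
              thus False using elim(1) bound[OF y n(1)] by blast
            qed
          qed
          hence "B \<in> null_sets M" using B by (simp add: AE_iff_null_sets)
          thus False using B_pos by (simp add: measure_def null_sets_def)
        qed
        thus ?thesis by (auto simp: zero_less_measure_iff)
      qed
    qed
    thus "\<exists>\<delta>>0. \<exists>a>0. \<forall>\<epsilon>>0. \<exists>n::nat.
        ereal (real n) \<le> ereal a * neg_log (measure M (oball M d x \<epsilon>)) \<and>
        measure M {y \<in> oball M d x \<epsilon>. d ((T ^^ n) x) ((T ^^ n) y) > \<delta>} > 0"
      using a' \<delta> r1(1) by (intro exI[of _ \<delta>'] exI[of _ a'] conjI allI impI) (auto simp: \<delta>'_def)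
  qed
qed

end
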